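(* Let $n\ge1$, let $\rho$ be an arbitrary metric on the sphere $S^n$ generating its standard topology, and let $Y$ be an arbitrary metric space. The following conditions are equivalent: (1) $d_{GH}^c\bigl((S^n,\rho),Y\bigr)=0$; (2) $Y$ is isometric to the sphere $(S^n,\rho)$.
   Context: All metric spaces are non-empty; $|xx'|$ denotes the distance between points $x,x'$ of a metric space. For maps $f\colon X\to Y$ and $g\colon Y\to X$ between metric spaces put $$\operatorname{dis} f=\sup_{x,x'\in X}\bigl||xx'|-|f(x)f(x')|\bigr|,\qquad \operatorname{codis}(f,g)=\sup_{x\in X,\,y\in Y}\bigl||x\,g(y)|-|f(x)\,y|\bigr|$$ ($\operatorname{dis} g$ is defined analogously). The continuous Gromov--Hausdorff distance is $d^c_{GH}(X,Y)=\frac12\inf\max\{\operatorname{dis} f,\operatorname{dis} g,\operatorname{codis}(f,g)\}\in[0,\infty]$, the infimum being over all continuous maps $f\colon X\to Y$ and $g\colon Y\to X$. *)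

theory Defs
  imports "HOL-Analysis.Analysis"
begin

text \<open>Values are taken in \<^typ>\<open>ennreal\<close>, since distortions of maps between unbounded spaces
  may be infinite. Only the values of the maps on the carriers \<^const>\<open>mspace\<close> matter.\<close>

definition distortion :: "'a metric \<Rightarrow> 'b metric \<Rightarrow> ('a \<Rightarrow> 'b) \<Rightarrow> ennreal" where
  "distortion X Y f =
     (SUP (x, x') \<in> mspace X \<times> mspace X. ennreal \<bar>mdist X x x' - mdist Y (f x) (f x')\<bar>)"

definition codistortion :: "'a metric \<Rightarrow> 'b metric \<Rightarrow> ('a \<Rightarrow> 'b) \<Rightarrow> ('b \<Rightarrow> 'a) \<Rightarrow> ennreal" where
  "codistortion X Y f g =
     (SUP (x, y) \<in> mspace X \<times> mspace Y. ennreal \<bar>mdist X x (g y) - mdist Y (f x) y\<bar>)"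

definition continuous_GH_dist :: "'a metric \<Rightarrow> 'b metric \<Rightarrow> ennreal" where
  "continuous_GH_dist X Y =
     (INF (f, g) \<in> {(f, g). continuous_map (mtopology_of X) (mtopology_of Y) f \<and>
                            continuous_map (mtopology_of Y) (mtopology_of X) g}.
        max (distortion X Y f) (max (distortion Y X g) (codistortion X Y f g))) / 2"

definition isometric :: "'a metric \<Rightarrow> 'b metric \<Rightarrow> bool" where
  "isometric X Y \<longleftrightarrow>
     (\<exists>\<phi>. bij_betw \<phi> (mspace X) (mspace Y) \<and>
          (\<forall>x\<in>mspace X. \<forall>x'\<in>mspace X. mdist Y (\<phi> x) (\<phi> x') = mdist X x x'))"

end

theory Submission
  imports Defs "HOL-Homology.Brouwer_Degree"
begin

text \<open>
  The distortions alone give, as a pointwise (Tychonoff) cluster point of the maps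
  \<open>g\<^sub>k : Y \<rightarrow> S\<close>, a distance-preserving map \<open>\<iota> : Y \<rightarrow> S\<close>; as \<open>Y\<close> is then totally bounded and the \<open>g\<^sub>k\<close>
  are nearly isometric, \<open>\<iota>\<close> is uniformly close to some \<open>g\<^sub>k\<close>. The codistortion makes
  \<open>g\<^sub>k \<circ> f\<^sub>k\<close>, and therefore \<open>\<iota> \<circ> f\<^sub>k\<close>, uniformly close to the identity of the sphere.
  If \<open>\<iota>\<close> missed a point, then \<open>\<iota> \<circ> f\<^sub>k\<close> would be nullhomotopic and, never being
  antipodal to the identity, homotopic to it, so the sphere would be contractible.
\<close>

section \<open>Spheres\<close>

lemma topspace_nsphere:
  "topspace (nsphere n) = {x. (\<Sum>i\<le>n. (x i)\<^sup>2) = 1 \<and> (\<forall>i>n. x i = 0)}"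
  by (simp add: nsphere)

lemma continuous_map_into_nsphere:
  "continuous_map X (nsphere n) f \<longleftrightarrow>
     (\<forall>i. continuous_map X euclideanreal (\<lambda>x. f x i)) \<and> f \<in> topspace X \<rightarrow> topspace (nsphere n)"
  by (auto simp: nsphere continuous_map_in_subtopology continuous_map_componentwise_UNIV)

text \<open>The sphere lies in a countable power of the real line, so compactness comes from
  Tychonoff: it is a closed subset of the cube with all coordinates in [-1,1].\<close>

lemma compact_space_nsphere: "compact_space (nsphere n)"
proof -
  let ?P = "powertop_real UNIV :: (nat \<Rightarrow> real) topology"
  let ?S = "{x::nat \<Rightarrow> real. (\<Sum>i\<le>n. (x i)\<^sup>2) = 1 \<and> (\<forall>i>n. x i = 0)}"
  have "compactin ?P (PiE UNIV (\<lambda>_. {-1..1}))"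
    by (simp add: compactin_PiE)
  moreover have "?S \<subseteq> PiE UNIV (\<lambda>_. {-1..1})"
  proof (clarsimp simp: PiE_def)
    fix x :: "nat \<Rightarrow> real" and i
    assume x: "(\<Sum>i\<le>n. (x i)\<^sup>2) = 1" "\<forall>i>n. x i = 0"
    have "(x i)\<^sup>2 \<le> 1"
    proof (cases "i \<le> n")
      case True
      then show ?thesis
        using x(1) member_le_sum[of i "{..n}" "\<lambda>i. (x i)\<^sup>2"] by simp
    qed (use x in auto)
    then show "-1 \<le> x i \<and> x i \<le> 1"
      unfolding abs_square_le_1 by linarith
  qed
  moreover have "closedin ?P ?S"
  proof -
    have proj: "continuous_map ?P euclideanreal (\<lambda>x. x i)" for i :: nat
      by (rule continuous_map_product_projection) simp
    have "continuous_map ?P euclideanreal (\<lambda>x. \<Sum>i\<le>n. (x i)\<^sup>2)"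
      by (intro continuous_map_sum continuous_map_real_pow proj) auto
    then have 1: "closedin ?P {x \<in> topspace ?P. (\<Sum>i\<le>n. (x i)\<^sup>2) \<in> {1}}"
      by (rule closedin_continuous_map_preimage) simp
    have 2: "closedin ?P {x \<in> topspace ?P. x i \<in> {0}}" for i :: nat
      using closedin_continuous_map_preimage[OF proj[of i], of "{0}"] by simp
    have "closedin ?P ({x \<in> topspace ?P. (\<Sum>i\<le>n. (x i)\<^sup>2) \<in> {1}} \<inter>
        (\<Inter>i\<in>{n<..}. {x \<in> topspace ?P. x i \<in> {0}}))"
      by (intro closedin_Int 1 closedin_INT 2) auto
    also have "{x \<in> topspace ?P. (\<Sum>i\<le>n. (x i)\<^sup>2) \<in> {1}} \<inter>
        (\<Inter>i\<in>{n<..}. {x \<in> topspace ?P. x i \<in> {0}}) = ?S"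
      by auto
    finally show ?thesis .
  qed
  ultimately show ?thesis
    unfolding nsphere by (rule compact_space_subtopology[OF closed_compactin])
qed

section \<open>Homotopies of maps into the sphere\<close>

lemma continuous_map_nsphere_normalize:
  assumes cont: "\<And>i. continuous_map X euclideanreal (\<lambda>x. h x i)"
    and zero: "\<And>x i. x \<in> topspace X \<Longrightarrow> i > n \<Longrightarrow> h x i = 0"
    and nonzero: "\<And>x. x \<in> topspace X \<Longrightarrow> (\<Sum>j\<le>n. (h x j)\<^sup>2) \<noteq> 0"
  shows "continuous_map X (nsphere n) (\<lambda>x i. h x i / sqrt (\<Sum>j\<le>n. (h x j)\<^sup>2))"
proof -
  have "continuous_map X euclideanreal (\<lambda>x. h x i / sqrt (\<Sum>j\<le>n. (h x j)\<^sup>2))" for i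
    by (intro continuous_map_real_divide continuous_map_sqrt continuous_map_sum
        continuous_map_real_pow cont) (use nonzero in auto)
  moreover have "(\<Sum>i\<le>n. (h x i / sqrt (\<Sum>j\<le>n. (h x j)\<^sup>2))\<^sup>2) = 1" if "x \<in> topspace X" for x
    using nonzero[OF that] by (simp add: power_divide sum_nonneg flip: sum_divide_distrib)
  ultimately show ?thesis
    by (auto simp: continuous_map_into_nsphere topspace_nsphere zero)
qed

text \<open>The segment from \<open>f x\<close> to \<open>g x\<close> meets the origin only if its
  endpoints are antipodal; otherwise its radial projection to the sphere is the homotopy.\<close>

lemma homotopic_nonantipodal_maps_nsphere:
  assumes f: "continuous_map X (nsphere n) f" and g: "continuous_map X (nsphere n) g"
    and nonanti: "\<And>x. x \<in> topspace X \<Longrightarrow> f x \<noteq> (\<lambda>i. - g x i)"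
  shows "homotopic_with (\<lambda>x. True) X (nsphere n) f g"
proof -
  let ?T = "top_of_set {0..1::real}"
  let ?l = "\<lambda>(t, x) i. (1 - t) * f x i + t * g x i"
  let ?h = "\<lambda>z i. ?l z i / sqrt (\<Sum>j\<le>n. (?l z j)\<^sup>2)"
  have sphere: "(\<Sum>i\<le>n. (f x i)\<^sup>2) = 1" "(\<Sum>i\<le>n. (g x i)\<^sup>2) = 1"
      "\<And>i. i > n \<Longrightarrow> f x i = 0" "\<And>i. i > n \<Longrightarrow> g x i = 0"
    if "x \<in> topspace X" for x
    using f g that by (auto simp: continuous_map_into_nsphere topspace_nsphere Pi_iff)
  have nonzero: "(\<Sum>j\<le>n. (?l (t, x) j)\<^sup>2) \<noteq> 0" if t: "t \<in> {0..1}" and x: "x \<in> topspace X" for t x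
  proof
    assume "(\<Sum>j\<le>n. (?l (t, x) j)\<^sup>2) = 0"
    then have eq: "(1 - t) * f x j = - (t * g x j)" if "j \<le> n" for j
      using that by (simp add: sum_nonneg_eq_0_iff eq_neg_iff_add_eq_0)
    \<comment> \<open>A zero on the segment makes vectors of lengths \<open>1 - t\<close> and
      \<open>t\<close> opposite. Equal lengths force the midpoint, where the endpoints are
      antipodal.\<close>
    have "(1 - t)\<^sup>2 = (\<Sum>j\<le>n. ((1 - t) * f x j)\<^sup>2)"
      using sphere[OF x] by (simp add: power_mult_distrib flip: sum_distrib_left)
    also have "\<dots> = (\<Sum>j\<le>n. (t * g x j)\<^sup>2)"
      by (intro sum.cong) (simp_all add: eq)
    also have "\<dots> = t\<^sup>2"
      using sphere[OF x] by (simp add: power_mult_distrib flip: sum_distrib_left)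
    finally have t2: "t = 1/2"
      by (simp add: power2_eq_iff)
    have "f x j = - g x j" for j
      using eq[of j] sphere[OF x] by (cases "j \<le> n") (auto simp: t2)
    then show False
      using nonanti[OF x] by blast
  qed
  have "continuous_map (prod_topology ?T X) (nsphere n) ?h"
  proof (rule continuous_map_nsphere_normalize)
    fix i
    have "continuous_map (prod_topology ?T X) euclideanreal (\<lambda>z. f (snd z) i)"
      "continuous_map (prod_topology ?T X) euclideanreal (\<lambda>z. g (snd z) i)"
      using f g continuous_map_compose[OF continuous_map_snd, of X euclideanreal _ ?T]
      by (auto simp: continuous_map_into_nsphere o_def)
    moreover have "continuous_map (prod_topology ?T X) euclideanreal fst"
      by (rule continuous_map_into_fulltopology[OF continuous_map_fst])
    ultimately show "continuous_map (prod_topology ?T X) euclideanreal (\<lambda>z. ?l z i)"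
      unfolding case_prod_unfold by (intro continuous_intros) auto
  qed (use nonzero sphere in auto)
  \<comment> \<open>At both ends the segment already has norm 1, so the projection does not move the
    point.\<close>
  moreover have "?h (0, x) = f x" "?h (1, x) = g x" if "x \<in> topspace X" for x
    using sphere[OF that] by auto
  ultimately show ?thesis
    unfolding homotopic_with[of X "\<lambda>x. True", simplified]
    by (intro exI[of _ ?h]) auto
qed

text \<open>Avoiding antipodes expresses closeness to \<open>id\<close> without reference to a
  metric. It makes \<open>f\<close> homotopic to \<open>id\<close>, while a missed value would make
  \<open>f\<close> nullhomotopic.\<close>

lemma surj_nsphere_if_nonantipodal:
  assumes f: "continuous_map (nsphere n) (nsphere n) f"
    and nonanti: "\<And>x. x \<in> topspace (nsphere n) \<Longrightarrow> f x \<noteq> (\<lambda>i. - x i)"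
  shows "f ` topspace (nsphere n) = topspace (nsphere n)"
proof (rule ccontr)
  assume "f ` topspace (nsphere n) \<noteq> topspace (nsphere n)"
  then obtain a where "homotopic_with (\<lambda>x. True) (nsphere n) (nsphere n) f (\<lambda>x. a)"
    using nullhomotopic_nonsurjective_sphere_map[OF f] by blast
  moreover have "homotopic_with (\<lambda>x. True) (nsphere n) (nsphere n) f id"
    using nonanti by (intro homotopic_nonantipodal_maps_nsphere f) (auto simp: continuous_map_id)
  ultimately have "contractible_space (nsphere n)"
    unfolding contractible_space_def by (meson homotopic_with_symD homotopic_with_trans)
  then show False
    using non_contractible_space_nsphere by blast
qed

section \<open>Antipodal points in an arbitrary metric\<close>

lemma antipode_in_nsphere: "x \<in> topspace (nsphere n) \<Longrightarrow> (\<lambda>i. - x i) \<in> topspace (nsphere n)"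
  by (simp add: topspace_nsphere)

text \<open>An arbitrary metric prescribes no distance between antipodes, but this distance is
  continuous and positive on a compact space and so has a positive minimum. The bound turns uniform
  closeness to the identity into avoidance of antipodes.\<close>

lemma nsphere_antipode_bounded_away:
  assumes S: "mtopology_of S = nsphere n"
  obtains \<delta> where "\<delta> > 0" "\<And>x. x \<in> mspace S \<Longrightarrow> \<delta> \<le> mdist S x (\<lambda>i. - x i)"
proof -
  let ?d = "\<lambda>x. mdist S x (\<lambda>i. - x i)"
  have top: "topspace (nsphere n) = mspace S"
    by (metis S topspace_mtopology_of)
  have "continuous_map (nsphere n) (nsphere n) (\<lambda>x i. - x i)"
    using antipode_in_nsphere
    by (auto simp: continuous_map_into_nsphere intro!: continuous_map_minus continuous_map_nsphere_projection)
  then have "continuous_map (nsphere n) euclideanreal ?d"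
    by (intro continuous_map_mdist) (auto simp: S)
  then have "compactin euclideanreal (?d ` mspace S)"
    using compact_space_nsphere[of n] top by (metis compact_space_def image_compactin)
  then have "compact (?d ` mspace S)"
    by simp
  moreover have "mspace S \<noteq> {}"
    using in_topspace_nsphere top by fastforce
  ultimately obtain x where x: "x \<in> mspace S" "\<And>x'. x' \<in> mspace S \<Longrightarrow> ?d x \<le> ?d x'"
    using compact_attains_inf[of "?d ` mspace S"] by auto
  \<comment> \<open>A point equal to its own antipode would have only zero coordinates, against norm
    1.\<close>
  have "x \<noteq> (\<lambda>i. - x i)"
  proof
    assume "x = (\<lambda>i. - x i)"
    then have "x i = 0" for i
      by (metis equation_minus_iff neg_equal_zero)
    then show False
      using x(1) by (simp add: topspace_nsphere flip: top)
  qed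
  then have "?d x > 0"
    using x(1) antipode_in_nsphere[of x n] top
    by (metis mdist_nonneg mdist_zero less_eq_real_def)
  then show thesis
    using that x by blast
qed

section \<open>Maps of small distortion\<close>

text \<open>A product over a large \<open>A\<close> is compact but need not be sequentially compact;
  hence a cluster point instead of the limit of a subsequence. Its basic neighbourhoods restrict
  finitely many coordinates, so \<open>N\<close> is finite; it lies in the closure of every tail, so
  \<open>j\<close> can be arbitrarily large.\<close>

lemma pointwise_cluster_map:
  fixes g :: "nat \<Rightarrow> 'b \<Rightarrow> 'a"
  assumes X: "compact_space (mtopology_of X)" and g: "\<And>k. g k \<in> A \<rightarrow> mspace X"
  obtains \<iota> where "\<iota> \<in> A \<rightarrow> mspace X"
    "\<And>N \<epsilon> k. finite N \<Longrightarrow> N \<subseteq> A \<Longrightarrow> \<epsilon> > 0 \<Longrightarrow> \<exists>j\<ge>k. \<forall>y\<in>N. mdist X (\<iota> y) (g j y) < \<epsilon>"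
proof -
  let ?P = "product_topology (\<lambda>_. mtopology_of X) A"
  \<comment> \<open>The tails of the sequence. Restriction to \<open>A\<close> makes the maps points
    of the product, whose elements are \<open>undefined\<close> outside \<open>A\<close>.\<close>
  let ?G = "\<lambda>k. (\<lambda>j. restrict (g j) A) ` {k..}"
  have top: "topspace ?P = (\<Pi>\<^sub>E y\<in>A. mspace X)"
    by simp
  have "(\<Inter>k. ?P closure_of ?G k) \<noteq> {}"
  proof (rule compact_space_imp_nest)
    show "compact_space ?P"
      using X by (simp add: compact_space_product_topology)
    have "?G k \<subseteq> topspace ?P" for k
      using g by (auto simp: PiE_iff Pi_iff)
    then have "?G k \<subseteq> ?P closure_of ?G k" for k
      by (rule closure_of_subset)
    then show "?P closure_of ?G k \<noteq> {}" for k
      by fastforce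
    show "decseq (\<lambda>k. ?P closure_of ?G k)"
      by (intro antimonoI closure_of_mono) auto
  qed auto
  then obtain \<iota> where \<iota>: "\<And>k. \<iota> \<in> ?P closure_of ?G k"
    by blast
  then have \<iota>_in: "\<iota> \<in> (\<Pi>\<^sub>E y\<in>A. mspace X)"
    using closure_of_subset_topspace top by fast
  show thesis
  proof
    show "\<iota> \<in> A \<rightarrow> mspace X"
      using \<iota>_in by auto
    fix N \<epsilon> and k :: nat
    assume N: "finite N" "N \<subseteq> A" and \<epsilon>: "\<epsilon> > (0::real)"
    let ?U = "\<lambda>y. if y \<in> N then mball_of X (\<iota> y) \<epsilon> else mspace X"
    have "openin ?P (\<Pi>\<^sub>E y\<in>A. ?U y)"
      unfolding openin_PiE_gen
    proof (intro disjI2 conjI ballI)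
      show "finite {y \<in> A. ?U y \<noteq> topspace (mtopology_of X)}"
        by (rule finite_subset[OF _ N(1)]) auto
      show "openin (mtopology_of X) (?U y)" for y
        by (metis Metric_space.openin_mball Metric_space_mspace_mdist mball_of_def mtopology_of_def
            openin_topspace topspace_mtopology_of)
    qed
    moreover have "mdist X (\<iota> y) (\<iota> y) < \<epsilon>" if "y \<in> A" for y
      using \<iota>_in \<epsilon> that mdist_zero[of "\<iota> y" X "\<iota> y"] by (metis PiE_mem)
    then have "\<iota> \<in> (\<Pi>\<^sub>E y\<in>A. ?U y)"
      using \<iota>_in by (auto simp: PiE_iff)
    ultimately obtain h where h: "h \<in> ?G k" "h \<in> (\<Pi>\<^sub>E y\<in>A. ?U y)"
      using \<iota>[of k] unfolding in_closure_of by blast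
    then obtain j where j: "j \<ge> k" "h = restrict (g j) A"
      by auto
    have "mdist X (\<iota> y) (g j y) < \<epsilon>" if "y \<in> N" for y
      using PiE_mem[OF h(2), of y] N(2) that j(2) by auto
    then show "\<exists>j\<ge>k. \<forall>y\<in>N. mdist X (\<iota> y) (g j y) < \<epsilon>"
      using j(1) by blast
  qed
qed

text \<open>Distances pass to the cluster map because the distortion bounds tend to 0. Nearness on a
  finite net then spreads to all of \<open>Y\<close>, since both \<iota> and \<open>g j\<close>
  nearly preserve the distance to a nearby net point.\<close>

lemma isometric_embedding_near_maps:
  fixes g :: "nat \<Rightarrow> 'b \<Rightarrow> 'a" and Y :: "'b metric"
  assumes X: "compact_space (mtopology_of X)" and g: "\<And>k. g k \<in> mspace Y \<rightarrow> mspace X"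
    and dis: "\<And>k y y'. y \<in> mspace Y \<Longrightarrow> y' \<in> mspace Y \<Longrightarrow>
        \<bar>mdist Y y y' - mdist X (g k y) (g k y')\<bar> < inverse (Suc k)"
  obtains \<iota> where "\<iota> \<in> mspace Y \<rightarrow> mspace X"
    "\<And>y y'. y \<in> mspace Y \<Longrightarrow> y' \<in> mspace Y \<Longrightarrow> mdist X (\<iota> y) (\<iota> y') = mdist Y y y'"
    "\<And>\<epsilon> k. \<epsilon> > 0 \<Longrightarrow> \<exists>j\<ge>k. \<forall>y\<in>mspace Y. mdist X (\<iota> y) (g j y) < \<epsilon>"
proof -
  obtain \<iota> where \<iota>: "\<iota> \<in> mspace Y \<rightarrow> mspace X" and near:
    "\<And>N \<epsilon> k. finite N \<Longrightarrow> N \<subseteq> mspace Y \<Longrightarrow> \<epsilon> > 0 \<Longrightarrow> \<exists>j\<ge>k. \<forall>y\<in>N. mdist X (\<iota> y) (g j y) < \<epsilon>"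
    by (rule pointwise_cluster_map[where g = g and A = "mspace Y", OF X g]) (rule that)
  have \<iota>_iso: "mdist X (\<iota> y) (\<iota> y') = mdist Y y y'" if y: "y \<in> mspace Y" "y' \<in> mspace Y" for y y'
  proof -
    have "\<bar>mdist X (\<iota> y) (\<iota> y') - mdist Y y y'\<bar> \<le> \<epsilon>" if "\<epsilon> > 0" for \<epsilon>
    proof -
      \<comment> \<open>Two thirds pay for replacing \<iota> by \<open>g j\<close> at the two
        points, one third for the distortion of \<open>g j\<close>.\<close>
      obtain k where k: "inverse (real (Suc k)) < \<epsilon>/3"
        using reals_Archimedean[OF divide_pos_pos[OF \<open>\<epsilon> > 0\<close> zero_less_numeral]] by blast
      obtain j where j: "j \<ge> k" "mdist X (\<iota> y) (g j y) < \<epsilon>/3" "mdist X (\<iota> y') (g j y') < \<epsilon>/3"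
        using near[of "{y, y'}" "\<epsilon>/3" k] y \<open>\<epsilon> > 0\<close> by auto
      have "inverse (real (Suc j)) \<le> inverse (Suc k)"
        using j(1) by (simp add: le_imp_inverse_le)
      moreover have "\<iota> y \<in> mspace X" "\<iota> y' \<in> mspace X" "g j y \<in> mspace X" "g j y' \<in> mspace X"
        using \<iota> g y by auto
      ultimately show ?thesis
        using dis[OF y, of j] j(2,3) k mdist_triangle[of "\<iota> y" X "g j y" "\<iota> y'"]
          mdist_triangle[of "g j y" X "g j y'" "\<iota> y'"] mdist_triangle[of "g j y" X "\<iota> y" "g j y'"]
          mdist_triangle[of "\<iota> y" X "\<iota> y'" "g j y'"] mdist_commute[of X "g j y" "\<iota> y"]
          mdist_commute[of X "g j y'" "\<iota> y'"]
        by linarith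
    qed
    then have "\<bar>mdist X (\<iota> y) (\<iota> y') - mdist Y y y'\<bar> \<le> 0"
      by (rule field_le_epsilon) simp
    then show ?thesis
      by simp
  qed
  have "\<exists>j\<ge>k. \<forall>y\<in>mspace Y. mdist X (\<iota> y) (g j y) < \<epsilon>" if "\<epsilon> > 0" for \<epsilon> k
  proof -
    interpret MX: Metric_space "mspace X" "mdist X" by auto
    have "MX.mtotally_bounded (mspace X)"
      using X MX.compactin_imp_mtotally_bounded[of "mspace X"]
      by (simp add: compact_space_def mtopology_of_def)
    then have tb: "MX.mtotally_bounded (\<iota> ` mspace Y)"
      using funcset_image[OF \<iota>] by (rule MX.mtotally_bounded_subset)
    have pos: "\<epsilon>/4 > 0"
      using \<open>\<epsilon> > 0\<close> by simp
    \<comment> \<open>The centres lie in the image of \<iota>, so the net pulls back to a finite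
      subset \<open>N\<close> of \<open>Y\<close>, where the pointwise approximation
      applies.\<close>
    obtain K where K: "finite K" "K \<subseteq> \<iota> ` mspace Y"
      "\<iota> ` mspace Y \<subseteq> (\<Union>x\<in>K. MX.mball x (\<epsilon>/4))"
      using tb[unfolded MX.mtotally_bounded_def, rule_format, OF pos] by blast
    obtain N where N: "N \<subseteq> mspace Y" "finite N" "K = \<iota> ` N"
      using finite_subset_image[OF K(1,2)] by blast
    obtain l where l: "inverse (real (Suc l)) < \<epsilon>/4"
      using reals_Archimedean[OF divide_pos_pos[OF \<open>\<epsilon> > 0\<close> zero_less_numeral]] by blast
    \<comment> \<open>With \<open>max k l\<close> the same index respects the requested
      \<open>k\<close> and has distortion below \<open>\<epsilon>/4\<close>.\<close>
    obtain j where j: "j \<ge> max k l" "\<And>y. y \<in> N \<Longrightarrow> mdist X (\<iota> y) (g j y) < \<epsilon>/4"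
      using near[OF N(2,1) pos, of "max k l"] by blast
    have lj: "inverse (real (Suc j)) \<le> inverse (Suc l)"
      using j(1) by (intro le_imp_inverse_le) auto
    \<comment> \<open>The path runs from \<open>\<iota> y\<close> over \<open>\<iota> z\<close> and
      \<open>g j z\<close> to \<open>g j y\<close>. The first two pieces cost a quarter each; the
      last costs one quarter for the distance from \<open>z\<close> to \<open>y\<close> and one for
      the distortion.\<close>
    have "mdist X (\<iota> y) (g j y) < \<epsilon>" if y: "y \<in> mspace Y" for y
    proof -
      obtain z where z: "z \<in> N" "mdist X (\<iota> z) (\<iota> y) < \<epsilon>/4"
        using subsetD[OF K(3) imageI[OF y]] unfolding N(3) by auto
      have z': "z \<in> mspace Y"
        using N(1) z(1) by blast
      then have "\<iota> y \<in> mspace X" "\<iota> z \<in> mspace X" "g j y \<in> mspace X" "g j z \<in> mspace X"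
        using \<iota> g y by auto
      then show ?thesis
        using dis[OF z' y, of j] lj l j(2)[OF z(1)] z(2) \<iota>_iso[OF z' y]
          mdist_triangle[of "\<iota> y" X "\<iota> z" "g j y"]
          mdist_triangle[of "\<iota> z" X "g j z" "g j y"] mdist_commute[of X "\<iota> y" "\<iota> z"]
        by linarith
    qed
    then show ?thesis
      using j(1) by auto
  qed
  with \<iota> \<iota>_iso show thesis
    by (rule that)
qed

section \<open>Maps provided by distance zero\<close>

lemma distortion_less_ennrealD:
  assumes "distortion X Y f < ennreal r" "x \<in> mspace X" "x' \<in> mspace X"
  shows "\<bar>mdist X x x' - mdist Y (f x) (f x')\<bar> < r"
proof -
  have "ennreal \<bar>mdist X x x' - mdist Y (f x) (f x')\<bar> \<le> distortion X Y f"
    unfolding distortion_def using assms(2,3) by (intro SUP_upper2[of "(x, x')"]) auto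
  with assms(1) show ?thesis
    by (metis abs_ge_zero ennreal_less_iff order_le_less_trans)
qed

lemma codistortion_less_ennrealD:
  assumes "codistortion X Y f g < ennreal r" "x \<in> mspace X" "y \<in> mspace Y"
  shows "\<bar>mdist X x (g y) - mdist Y (f x) y\<bar> < r"
proof -
  have "ennreal \<bar>mdist X x (g y) - mdist Y (f x) y\<bar> \<le> codistortion X Y f g"
    unfolding codistortion_def using assms(2,3) by (intro SUP_upper2[of "(x, y)"]) auto
  with assms(1) show ?thesis
    by (metis abs_ge_zero ennreal_less_iff order_le_less_trans)
qed

lemma continuous_GH_dist_eq_0D:
  assumes "continuous_GH_dist X Y = 0" "r > 0"
  obtains f g where
    "continuous_map (mtopology_of X) (mtopology_of Y) f"
    "continuous_map (mtopology_of Y) (mtopology_of X) g"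
    "distortion X Y f < ennreal r" "distortion Y X g < ennreal r" "codistortion X Y f g < ennreal r"
proof -
  \<comment> \<open>Half of the infimum is 0 only if the infimum is, so some admissible pair falls
    strictly below \<open>r\<close>.\<close>
  have "(INF (f, g) \<in> {(f, g). continuous_map (mtopology_of X) (mtopology_of Y) f \<and>
                            continuous_map (mtopology_of Y) (mtopology_of X) g}.
        max (distortion X Y f) (max (distortion Y X g) (codistortion X Y f g))) < ennreal r"
    using assms by (simp add: continuous_GH_dist_def ennreal_divide_eq_0_iff)
  then show thesis
    unfolding INF_less_iff using that by auto
qed

text \<open>This is what compactness yields without any topology of spheres: one \<iota> serves
  every \<epsilon>, while \<open>f\<close> varies with it. The composite is close to the identity
  because \<open>g \<circ> f\<close> is, and \<iota> is close to \<open>g\<close>.\<close>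

lemma continuous_GH_dist_eq_0_compactD:
  assumes "continuous_GH_dist X Y = 0" and X: "compact_space (mtopology_of X)"
  obtains \<iota> where "\<iota> \<in> mspace Y \<rightarrow> mspace X"
    "\<And>y y'. y \<in> mspace Y \<Longrightarrow> y' \<in> mspace Y \<Longrightarrow> mdist X (\<iota> y) (\<iota> y') = mdist Y y y'"
    "\<And>\<epsilon>. \<epsilon> > 0 \<Longrightarrow> \<exists>f. continuous_map (mtopology_of X) (mtopology_of Y) f \<and>
       (\<forall>x\<in>mspace X. mdist X x (\<iota> (f x)) < \<epsilon>)"
proof -
  have "\<exists>f g. continuous_map (mtopology_of X) (mtopology_of Y) f \<and>
      continuous_map (mtopology_of Y) (mtopology_of X) g \<and>
      distortion Y X g < ennreal (inverse (Suc k)) \<and>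
      codistortion X Y f g < ennreal (inverse (Suc k))" for k
    using continuous_GH_dist_eq_0D[OF assms(1), of "inverse (Suc k)"] by force
  then obtain f g where f: "\<And>k. continuous_map (mtopology_of X) (mtopology_of Y) (f k)"
    and g: "\<And>k. continuous_map (mtopology_of Y) (mtopology_of X) (g k)"
    and dis: "\<And>k. distortion Y X (g k) < ennreal (inverse (Suc k))"
    and codis: "\<And>k. codistortion X Y (f k) (g k) < ennreal (inverse (Suc k))"
    by metis
  have f': "f k \<in> mspace X \<rightarrow> mspace Y" and g': "g k \<in> mspace Y \<rightarrow> mspace X" for k
    using continuous_map_funspace[OF f] continuous_map_funspace[OF g] by auto
  obtain \<iota> where \<iota>: "\<iota> \<in> mspace Y \<rightarrow> mspace X"
    "\<And>y y'. y \<in> mspace Y \<Longrightarrow> y' \<in> mspace Y \<Longrightarrow> mdist X (\<iota> y) (\<iota> y') = mdist Y y y'"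
    and near: "\<And>\<epsilon> k. \<epsilon> > 0 \<Longrightarrow> \<exists>j\<ge>k. \<forall>y\<in>mspace Y. mdist X (\<iota> y) (g j y) < \<epsilon>"
    by (rule isometric_embedding_near_maps[OF X g' distortion_less_ennrealD[OF dis]]) (assumption | rule that)+
  have "\<exists>f. continuous_map (mtopology_of X) (mtopology_of Y) f \<and>
       (\<forall>x\<in>mspace X. mdist X x (\<iota> (f x)) < \<epsilon>)" if "\<epsilon> > 0" for \<epsilon>
  proof -
    obtain k where k: "inverse (real (Suc k)) < \<epsilon>/2"
      using reals_Archimedean[OF divide_pos_pos[OF \<open>\<epsilon> > 0\<close> zero_less_numeral]] by blast
    obtain j where j: "j \<ge> k" "\<And>y. y \<in> mspace Y \<Longrightarrow> mdist X (\<iota> y) (g j y) < \<epsilon>/2"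
      using near[of "\<epsilon>/2" k] half_gt_zero[OF \<open>\<epsilon> > 0\<close>] by blast
    have kj: "inverse (real (Suc j)) \<le> inverse (Suc k)"
      using j(1) by (simp add: le_imp_inverse_le)
    have "mdist X x (\<iota> (f j x)) < \<epsilon>" if x: "x \<in> mspace X" for x
    proof -
      have y: "f j x \<in> mspace Y"
        using f' x by auto
      \<comment> \<open>For \<open>y = f j x\<close> one of the two distances compared by the
        codistortion vanishes, so the other, from \<open>x\<close> to \<open>g j (f j x)\<close>, is
        small.\<close>
      have "mdist Y (f j x) (f j x) = 0"
        using mdist_zero[OF y y] by blast
      then have "mdist X x (g j (f j x)) < \<epsilon>/2"
        using codistortion_less_ennrealD[OF codis x y, of j] k kj by linarith
      moreover have "g j (f j x) \<in> mspace X" "\<iota> (f j x) \<in> mspace X"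
        using y g' \<iota>(1) by auto
      ultimately show ?thesis
        using j(2)[OF y] x mdist_triangle[of x X "g j (f j x)" "\<iota> (f j x)"]
          mdist_commute[of X "g j (f j x)"] by simp
    qed
    then show ?thesis
      using f by blast
  qed
  with \<iota> show thesis
    by (rule that)
qed

section \<open>Distance-preserving maps and isometric spaces\<close>

lemma continuous_map_isometric:
  assumes "\<phi> \<in> mspace X \<rightarrow> mspace Y"
    and "\<And>x x'. x \<in> mspace X \<Longrightarrow> x' \<in> mspace X \<Longrightarrow> mdist Y (\<phi> x) (\<phi> x') = mdist X x x'"
  shows "continuous_map (mtopology_of X) (mtopology_of Y) \<phi>"
  using assms by (intro Lipschitz_continuous_imp_continuous_map)
    (auto simp: Lipschitz_continuous_map_def intro!: exI[of _ 1])

text \<open>An isometry and its inverse form a pair of zero cost. The isometry \<phi> goes from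
  \<open>Y\<close> to \<open>X\<close> and takes the role of \<open>g\<close>; its inverse \<psi>
  takes that of \<open>f\<close>.\<close>

lemma continuous_GH_dist_eq_0_if_isometric:
  assumes "isometric Y X"
  shows "continuous_GH_dist X Y = 0"
proof -
  obtain \<phi> where bij: "bij_betw \<phi> (mspace Y) (mspace X)"
    and \<phi>: "\<And>y y'. y \<in> mspace Y \<Longrightarrow> y' \<in> mspace Y \<Longrightarrow> mdist X (\<phi> y) (\<phi> y') = mdist Y y y'"
    using assms unfolding isometric_def by blast
  define \<psi> where "\<psi> = inv_into (mspace Y) \<phi>"
  have \<psi>_in: "\<psi> x \<in> mspace Y" and \<phi>\<psi>: "\<phi> (\<psi> x) = x" if "x \<in> mspace X" for x
    using bij that unfolding \<psi>_def
    by (metis bij_betw_imp_surj_on inv_into_into, metis bij_betw_inv_into_right)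
  have \<phi>_in: "\<phi> y \<in> mspace X" if "y \<in> mspace Y" for y
    using bij that by (rule bij_betwE[rule_format])
  have \<psi>: "mdist Y (\<psi> x) (\<psi> x') = mdist X x x'" if "x \<in> mspace X" "x' \<in> mspace X" for x x'
    using \<phi>[OF \<psi>_in \<psi>_in] \<phi>\<psi> that by metis
  \<comment> \<open>Zero codistortion: write \<open>x\<close> as \<open>\<phi> (\<psi> x)\<close>
    and use that \<phi> preserves distances.\<close>
  have \<psi>\<phi>: "mdist X x (\<phi> y) = mdist Y (\<psi> x) y" if "x \<in> mspace X" "y \<in> mspace Y" for x y
    using \<phi>[OF \<psi>_in] \<phi>\<psi> that by metis
  have "continuous_map (mtopology_of X) (mtopology_of Y) \<psi>"
    "continuous_map (mtopology_of Y) (mtopology_of X) \<phi>"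
    using \<phi> \<psi> \<phi>_in \<psi>_in by (auto intro!: continuous_map_isometric)
  moreover have "max (distortion X Y \<psi>) (max (distortion Y X \<phi>) (codistortion X Y \<psi> \<phi>)) \<le> 0"
    unfolding distortion_def codistortion_def by (intro max.boundedI SUP_least) (auto simp: \<phi> \<psi> \<psi>\<phi>)
  ultimately have "(INF (f, g) \<in> {(f, g). continuous_map (mtopology_of X) (mtopology_of Y) f \<and>
                            continuous_map (mtopology_of Y) (mtopology_of X) g}.
        max (distortion X Y f) (max (distortion Y X g) (codistortion X Y f g))) \<le> 0"
    by (intro INF_lower2[of "(\<psi>, \<phi>)"]) auto
  then show ?thesis
    by (simp add: continuous_GH_dist_def)
qed

section \<open>Spaces at distance zero from a sphere\<close>

theorem corollary5p5:
  fixes n :: nat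
    and \<rho> :: "(nat \<Rightarrow> real) \<Rightarrow> (nat \<Rightarrow> real) \<Rightarrow> real"
    and Y :: "'b metric"
  assumes "n \<ge> 1"
    and "Metric_space (topspace (nsphere n)) \<rho>"
    and "Metric_space.mtopology (topspace (nsphere n)) \<rho> = nsphere n"
    and "mspace Y \<noteq> {}"
  shows "continuous_GH_dist (metric (topspace (nsphere n), \<rho>)) Y = 0 \<longleftrightarrow>
         isometric Y (metric (topspace (nsphere n), \<rho>))"
proof
  let ?S = "metric (topspace (nsphere n), \<rho>)"
  have space: "mspace ?S = topspace (nsphere n)"
    using assms(2) by (simp add: Metric_space.mspace_metric)
  have S: "mtopology_of ?S = nsphere n"
    using assms(2,3) by (simp add: mtopology_of_def Metric_space.mspace_metric Metric_space.mdist_metric)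
  have compact: "compact_space (mtopology_of ?S)"
    unfolding S by (rule compact_space_nsphere)
  assume "continuous_GH_dist ?S Y = 0"
  then obtain \<iota> where \<iota>: "\<iota> \<in> mspace Y \<rightarrow> mspace ?S"
    "\<And>y y'. y \<in> mspace Y \<Longrightarrow> y' \<in> mspace Y \<Longrightarrow> mdist ?S (\<iota> y) (\<iota> y') = mdist Y y y'"
    and near: "\<And>\<epsilon>. \<epsilon> > 0 \<Longrightarrow> \<exists>f. continuous_map (mtopology_of ?S) (mtopology_of Y) f \<and>
       (\<forall>x\<in>mspace ?S. mdist ?S x (\<iota> (f x)) < \<epsilon>)"
    by (rule continuous_GH_dist_eq_0_compactD[OF _ compact]) (rule that)
  obtain \<delta> where \<delta>: "\<delta> > 0" "\<And>x. x \<in> mspace ?S \<Longrightarrow> \<delta> \<le> mdist ?S x (\<lambda>i. - x i)"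
    by (rule nsphere_antipode_bounded_away[OF S]) (rule that)
  \<comment> \<open>The tolerance is \<delta> so that a point sent by
    \<open>\<iota> \<circ> f\<close> to its antipode would be moved both by at least \<delta> and by
    less.\<close>
  obtain f where f: "continuous_map (nsphere n) (mtopology_of Y) f"
    "\<And>x. x \<in> mspace ?S \<Longrightarrow> mdist ?S x (\<iota> (f x)) < \<delta>"
    using near[OF \<delta>(1)] unfolding S by blast
  have "continuous_map (nsphere n) (nsphere n) (\<iota> \<circ> f)"
    using f(1) continuous_map_isometric[OF \<iota>] unfolding S by (rule continuous_map_compose)
  moreover have "(\<iota> \<circ> f) x \<noteq> (\<lambda>i. - x i)" if "x \<in> topspace (nsphere n)" for x
  proof
    assume "(\<iota> \<circ> f) x = (\<lambda>i. - x i)"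
    with \<delta>(2)[of x] f(2)[of x] that show False
      unfolding space by simp
  qed
  ultimately have "(\<iota> \<circ> f) ` mspace ?S = mspace ?S"
    unfolding space by (rule surj_nsphere_if_nonantipodal)
  moreover have "f ` mspace ?S \<subseteq> mspace Y"
    using continuous_map_image_subset_topspace[OF f(1)] space by simp
  \<comment> \<open>The composite covers the sphere, and its image is contained in that of
    \<iota>.\<close>
  ultimately have "mspace ?S \<subseteq> \<iota> ` mspace Y"
    by (metis image_comp image_mono)
  then have "\<iota> ` mspace Y = mspace ?S"
    using funcset_image[OF \<iota>(1)] by (rule subset_antisym[rotated])
  moreover have "inj_on \<iota> (mspace Y)"
  proof (rule inj_onI)
    fix y y'
    assume y: "y \<in> mspace Y" "y' \<in> mspace Y" and eq: "\<iota> y = \<iota> y'"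
    then have "mdist Y y y' = 0"
      using \<iota>(2)[OF y] funcset_mem[OF \<iota>(1) y(1)] mdist_zero[of "\<iota> y" ?S "\<iota> y"] by metis
    then show "y = y'"
      using mdist_zero[OF y] by blast
  qed
  ultimately show "isometric Y ?S"
    unfolding isometric_def by (intro exI[of _ \<iota>] conjI ballI bij_betw_imageI \<iota>(2))
qed (rule continuous_GH_dist_eq_0_if_isometric)

end
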